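(* Let $G=(V,E)$ be a finite simple undirected graph with maximum degree $\Delta(G)$. Let $V_{max}$ be the set of vertices of degree $\Delta(G)$, and partition $V_{max}=V_1\cup\dots\cup V_m$ into the equivalence classes of the relation $x\equiv y \iff N_G(x)=N_G(y)$. For $i\in[m]$ let $N_i$ be the common closed neighborhood of the vertices in $V_i$ and $V_i'=N_i\setminus V_i$. Then $\mathrm{VCD}(\mathcal{C}_{star}(G))=\Delta(G)+1$ if and only if there exist an index $i\in[m]$ and a vertex $v\notin N_i$ such that $V_i'\subseteq N_G(v)$.
   Context: $N_G^o(x)=\{y:\{x,y\}\in E\}$ is the open neighborhood and $N_G(x)=N_G^o(x)\cup\{x\}$ the closed neighborhood of $x$. The concept class $\mathcal{C}_{star}(G)$ over domain $V$ is $\{X\cup\{x\} : x\in V,\ X\subseteq N_G^o(x)\}$. A set $S\subseteq V$ is shattered by a class $\mathcal{C}$ if for every $S'\subseteq S$ there is $C\in\mathcal{C}$ with $S\cap C=S'$; $\mathrm{VCD}(\mathcal{C})$ is the largest size of a shattered set. *)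

theory Defs
  imports Main
begin

definition simple_graph :: "'a set \<Rightarrow> 'a set set \<Rightarrow> bool" where
  "simple_graph V E \<longleftrightarrow> finite V \<and> (\<forall>e\<in>E. e \<subseteq> V \<and> card e = 2)"

definition open_nbhd :: "'a set set \<Rightarrow> 'a \<Rightarrow> 'a set" where
  "open_nbhd E x = {y. {x, y} \<in> E}"

definition closed_nbhd :: "'a set set \<Rightarrow> 'a \<Rightarrow> 'a set" where
  "closed_nbhd E x = open_nbhd E x \<union> {x}"

definition degree :: "'a set set \<Rightarrow> 'a \<Rightarrow> nat" where
  "degree E x = card (open_nbhd E x)"

(* Sup on nat is the maximum for finite nonempty sets and 0 for the empty set, so
   the graph without vertices gets maximum degree 0. *)
definition max_degree :: "'a set \<Rightarrow> 'a set set \<Rightarrow> nat" where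
  "max_degree V E = Sup (degree E ` V)"

definition max_degree_vertices :: "'a set \<Rightarrow> 'a set set \<Rightarrow> 'a set" where
  "max_degree_vertices V E = {x \<in> V. degree E x = max_degree V E}"

definition twin_rel :: "'a set \<Rightarrow> 'a set set \<Rightarrow> 'a rel" where
  "twin_rel V E = {(x, y). x \<in> max_degree_vertices V E \<and> y \<in> max_degree_vertices V E \<and>
                           closed_nbhd E x = closed_nbhd E y}"

lemma equiv_twin_rel: "equiv (max_degree_vertices V E) (twin_rel V E)"
  by (intro equivI refl_onI symI transI) (auto simp: twin_rel_def)

definition star_class :: "'a set \<Rightarrow> 'a set set \<Rightarrow> 'a set set" where
  "star_class V E = {X \<union> {x} | x X. x \<in> V \<and> X \<subseteq> open_nbhd E x}"

definition shattered :: "'a set set \<Rightarrow> 'a set \<Rightarrow> bool" where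
  "shattered \<C> S \<longleftrightarrow> (\<forall>S'\<subseteq>S. \<exists>C\<in>\<C>. S \<inter> C = S')"

(* The largest size of a shattered subset of the finite domain V; the empty class,
   which shatters no set at all, gets the value 0. *)
definition VCD :: "'a set \<Rightarrow> 'a set set \<Rightarrow> nat" where
  "VCD V \<C> = Sup {card S | S. S \<subseteq> V \<and> shattered \<C> S}"

end

theory Submission imports Defs begin

text \<open>
  A member of the star class with centre \<open>x\<close> lies in the closed neighborhood of \<open>x\<close>, so a shattered
  set of size \<open>\<Delta> + 1\<close> is the closed neighborhood \<open>N\<^sub>i\<close> of a vertex of maximum degree. A subset of
  \<open>N\<^sub>i\<close> meeting \<open>V\<^sub>i\<close> is a star centred in \<open>V\<^sub>i\<close>, so only the subsets of \<open>N\<^sub>i - V\<^sub>i\<close> matter, and these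
  are all cut out by stars centred at a suitable \<open>v\<close> outside \<open>N\<^sub>i\<close>. Conversely, the centre \<open>v\<close> of a
  star that cuts out \<open>N\<^sub>i - V\<^sub>i\<close> cannot lie in \<open>V\<^sub>i\<close>; were it in \<open>N\<^sub>i - V\<^sub>i\<close>, it would be adjacent to
  all of \<open>V\<^sub>i\<close> as well, so that \<open>N\<^sub>i\<close> would be contained in its closed neighborhood and equal to it by
  maximality of the degree, forcing \<open>v \<in> V\<^sub>i\<close>.
\<close>

lemma open_nbhd_sym: "y \<in> open_nbhd E x \<longleftrightarrow> x \<in> open_nbhd E y"
  by (simp add: open_nbhd_def insert_commute)

lemma closed_nbhd_sym: "y \<in> closed_nbhd E x \<longleftrightarrow> x \<in> closed_nbhd E y"
  using open_nbhd_sym[of y E x] by (auto simp: closed_nbhd_def)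

lemma self_in_closed_nbhd: "x \<in> closed_nbhd E x"
  by (simp add: closed_nbhd_def)

text \<open>A loop would be the edge \<open>{x, x}\<close>, of cardinality 1 instead of 2. This is
  what makes a closed neighborhood have exactly one element more than the degree.\<close>

lemma not_in_open_nbhd_self:
  assumes "simple_graph V E"
  shows "x \<notin> open_nbhd E x"
  using assms by (fastforce simp: simple_graph_def open_nbhd_def)

lemma closed_nbhd_subset:
  assumes "simple_graph V E" and "x \<in> V"
  shows "closed_nbhd E x \<subseteq> V"
  using assms by (auto simp: simple_graph_def open_nbhd_def closed_nbhd_def)

lemma finite_closed_nbhd:
  assumes "simple_graph V E" and "x \<in> V"
  shows "finite (closed_nbhd E x)"
  using closed_nbhd_subset[OF assms] assms(1) finite_subset unfolding simple_graph_def by blast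

lemma card_closed_nbhd:
  assumes "simple_graph V E" and "x \<in> V"
  shows "card (closed_nbhd E x) = degree E x + 1"
  using finite_closed_nbhd[OF assms] not_in_open_nbhd_self[OF assms(1), of x]
  by (simp add: closed_nbhd_def degree_def)

lemma degree_le_max_degree:
  assumes "simple_graph V E" and "x \<in> V"
  shows "degree E x \<le> max_degree V E"
  using assms unfolding max_degree_def simple_graph_def
  by (intro cSup_upper) auto

text \<open>No closed neighborhood has more than \<open>max_degree V E + 1\<close> elements, so
  \<open>S\<close> already fills the one containing it.\<close>

lemma max_degree_vertex_if_closed_nbhd_large:
  assumes G: "simple_graph V E" and v: "v \<in> V"
    and "S \<subseteq> closed_nbhd E v" and "card S = max_degree V E + 1"
  shows "v \<in> max_degree_vertices V E" and "closed_nbhd E v = S"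
proof -
  have "card (closed_nbhd E v) \<le> card S"
    using assms(4) card_closed_nbhd[OF G v] degree_le_max_degree[OF G v] by simp
  then show "closed_nbhd E v = S"
    using assms(3) finite_closed_nbhd[OF G v] by (metis card_seteq)
  then show "v \<in> max_degree_vertices V E"
    using assms(4) card_closed_nbhd[OF G v] v by (simp add: max_degree_vertices_def)
qed

text \<open>A star is any set lying in the closed neighborhood of one of its own members; this form
  removes the leaf set \<open>X\<close> from later arguments.\<close>

lemma star_class_iff:
  "C \<in> star_class V E \<longleftrightarrow> (\<exists>v\<in>V. v \<in> C \<and> C \<subseteq> closed_nbhd E v)"
proof
  assume "\<exists>v\<in>V. v \<in> C \<and> C \<subseteq> closed_nbhd E v"
  then obtain v where v: "v \<in> V" "v \<in> C" "C \<subseteq> closed_nbhd E v"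
    by blast
  then have "C = (C - {v}) \<union> {v}" "C - {v} \<subseteq> open_nbhd E v"
    unfolding closed_nbhd_def by blast+
  with v(1) show "C \<in> star_class V E"
    unfolding star_class_def by blast
qed (auto simp: star_class_def closed_nbhd_def)

text \<open>The star cutting out all of \<open>S\<close> contains \<open>S\<close>, and its centre
  is the required \<open>v\<close>.\<close>

lemma shattered_star_class_subset_closed_nbhd:
  assumes "shattered (star_class V E) S"
  obtains v where "v \<in> V" and "S \<subseteq> closed_nbhd E v"
proof -
  obtain C where "C \<in> star_class V E" "S \<inter> C = S"
    using assms unfolding shattered_def by blast
  then show ?thesis
    using that unfolding star_class_iff by blast
qed

lemma card_shattered_star_class_le:
  assumes "simple_graph V E" and "shattered (star_class V E) S"
  shows "card S \<le> max_degree V E + 1"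
proof -
  obtain v where v: "v \<in> V" "S \<subseteq> closed_nbhd E v"
    using assms(2) by (rule shattered_star_class_subset_closed_nbhd)
  have "card S \<le> card (closed_nbhd E v)"
    using v finite_closed_nbhd[OF assms(1)] by (simp add: card_mono)
  then show ?thesis
    using card_closed_nbhd[OF assms(1) v(1)] degree_le_max_degree[OF assms(1) v(1)] by simp
qed

text \<open>The bound \<open>Suc k\<close> turns the supremum into an attained maximum. The value is
  a successor because 0 is also the supremum of the empty set, where no shattered set
  exists.\<close>

lemma VCD_eq_Suc_iff:
  assumes "finite V" and "\<And>S. S \<subseteq> V \<Longrightarrow> shattered \<C> S \<Longrightarrow> card S \<le> Suc k"
  shows "VCD V \<C> = Suc k \<longleftrightarrow> (\<exists>S\<subseteq>V. shattered \<C> S \<and> card S = Suc k)"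
proof -
  let ?A = "{card S | S. S \<subseteq> V \<and> shattered \<C> S}"
  have "?A \<subseteq> card ` Pow V" by auto
  then have fin: "finite ?A" using assms(1) by (meson finite_Pow_iff finite_imageI finite_subset)
  have "VCD V \<C> = Suc k \<longleftrightarrow> Suc k \<in> ?A"
  proof
    assume "VCD V \<C> = Suc k"
    \<comment> \<open>\<open>Sup\<close> is 0 on the empty set, which differs from
      \<open>Suc k\<close>; on a nonempty set it unfolds to \<open>Max\<close>.\<close>
    then have "?A \<noteq> {}" and "Max ?A = Suc k"
      by (simp_all only: VCD_def Sup_nat_def split: if_splits) simp
    then show "Suc k \<in> ?A"
      using Max_in[OF fin] by metis
  next
    assume "Suc k \<in> ?A"
    then show "VCD V \<C> = Suc k"
      unfolding VCD_def by (rule cSup_eq_maximum) (use assms(2) in blast)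
  qed
  also have "\<dots> \<longleftrightarrow> (\<exists>S\<subseteq>V. shattered \<C> S \<and> card S = Suc k)"
    unfolding mem_Collect_eq by metis
  finally show ?thesis .
qed

text \<open>The criterion for a single twin class, given by a representative \<open>x\<close>:
  \<open>?N\<close> stands for its common closed neighborhood and \<open>?T\<close> for the class
  itself.\<close>

lemma shattered_closed_nbhd_iff:
  assumes G: "simple_graph V E" and x: "x \<in> max_degree_vertices V E"
  shows "shattered (star_class V E) (closed_nbhd E x) \<longleftrightarrow>
         (\<exists>v\<in>V. v \<notin> closed_nbhd E x \<and>
            closed_nbhd E x - twin_rel V E `` {x} \<subseteq> closed_nbhd E v)"
    (is "shattered _ ?N \<longleftrightarrow> (\<exists>v\<in>V. v \<notin> ?N \<and> ?N - ?T \<subseteq> _)")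
proof
  have card_N: "card ?N = max_degree V E + 1"
    using x card_closed_nbhd[OF G] by (simp add: max_degree_vertices_def)
  have T: "y \<in> ?T \<longleftrightarrow> y \<in> max_degree_vertices V E \<and> closed_nbhd E y = ?N" for y
    using x unfolding twin_rel_def Image_singleton_iff mem_Collect_eq case_prod_conv by metis
  {
    assume "shattered (star_class V E) ?N"
    then obtain C where "C \<in> star_class V E" and C: "?N \<inter> C = ?N - ?T"
      unfolding shattered_def by (meson Diff_subset)
    then obtain v where v: "v \<in> V" "v \<in> C" "C \<subseteq> closed_nbhd E v"
      unfolding star_class_iff by blast
    have sub: "?N - ?T \<subseteq> closed_nbhd E v" using C v(3) by blast
    have "v \<notin> ?N"
    proof
      assume vN: "v \<in> ?N"
      then have "v \<notin> ?T" using C v(2) by blast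
      \<comment> \<open>Each twin has closed neighborhood \<open>?N\<close>, which contains
        \<open>v\<close>; symmetry turns this around.\<close>
      have "?T \<subseteq> closed_nbhd E v"
      proof
        fix w assume "w \<in> ?T"
        then have "v \<in> closed_nbhd E w" using vN T by metis
        then show "w \<in> closed_nbhd E v" by (simp only: closed_nbhd_sym)
      qed
      with sub have "?N \<subseteq> closed_nbhd E v" by blast
      from max_degree_vertex_if_closed_nbhd_large[OF G v(1) this card_N]
      show False using \<open>v \<notin> ?T\<close> T by metis
    qed
    with sub v(1) show "\<exists>v\<in>V. v \<notin> ?N \<and> ?N - ?T \<subseteq> closed_nbhd E v" by blast
  }
  assume "\<exists>v\<in>V. v \<notin> ?N \<and> ?N - ?T \<subseteq> closed_nbhd E v"
  then obtain v where v: "v \<in> V" "v \<notin> ?N" "?N - ?T \<subseteq> closed_nbhd E v" by blast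
  show "shattered (star_class V E) ?N"
    unfolding shattered_def
  proof (intro allI impI)
    fix S assume S: "S \<subseteq> ?N"
    show "\<exists>C\<in>star_class V E. ?N \<inter> C = S"
    proof (cases "S \<inter> ?T = {}")
      case True
      \<comment> \<open>Here \<open>S\<close> lies in \<open>?N - ?T\<close>, so it can serve as
        leaves at \<open>v\<close>; the centre leaves no trace on \<open>?N\<close>.\<close>
      then have "insert v S \<in> star_class V E"
        using v S self_in_closed_nbhd[of v E] unfolding star_class_iff by blast
      moreover have "?N \<inter> insert v S = S" using v(2) S by blast
      ultimately show ?thesis by blast
    next
      case False
      then obtain w where "w \<in> S" and "w \<in> ?T" by blast
      \<comment> \<open>A twin \<open>w\<close> in \<open>S\<close> makes \<open>S\<close> itself a
        star, since its closed neighborhood is \<open>?N\<close>.\<close>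
      then have "w \<in> V" and "S \<subseteq> closed_nbhd E w"
        using T[of w] S by (simp_all add: max_degree_vertices_def)
      with \<open>w \<in> S\<close> have "S \<in> star_class V E" unfolding star_class_iff by blast
      moreover have "?N \<inter> S = S" using S by blast
      ultimately show ?thesis by blast
    qed
  qed
qed

text \<open>A shattered set of the extremal size lies in a closed neighborhood and hence equals it,
  so only these candidates need testing.\<close>

lemma VCD_star_class_eq_iff:
  assumes G: "simple_graph V E"
  shows "VCD V (star_class V E) = max_degree V E + 1 \<longleftrightarrow>
         (\<exists>x\<in>max_degree_vertices V E. shattered (star_class V E) (closed_nbhd E x))"
proof -
  have "VCD V (star_class V E) = max_degree V E + 1 \<longleftrightarrow>
        (\<exists>S\<subseteq>V. shattered (star_class V E) S \<and> card S = max_degree V E + 1)"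
    using VCD_eq_Suc_iff[of V "star_class V E" "max_degree V E"]
      card_shattered_star_class_le[OF G] G by (simp add: simple_graph_def)
  also have "\<dots> \<longleftrightarrow> (\<exists>x\<in>max_degree_vertices V E. shattered (star_class V E) (closed_nbhd E x))"
  proof
    assume "\<exists>S\<subseteq>V. shattered (star_class V E) S \<and> card S = max_degree V E + 1"
    then obtain S where S: "shattered (star_class V E) S" "card S = max_degree V E + 1" by blast
    from S(1) obtain x where "x \<in> V" "S \<subseteq> closed_nbhd E x"
      by (rule shattered_star_class_subset_closed_nbhd)
    from max_degree_vertex_if_closed_nbhd_large[OF G this S(2)] S(1)
    show "\<exists>x\<in>max_degree_vertices V E. shattered (star_class V E) (closed_nbhd E x)" by blast
  next
    assume "\<exists>x\<in>max_degree_vertices V E. shattered (star_class V E) (closed_nbhd E x)"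
    then obtain x where "x \<in> V" "degree E x = max_degree V E"
      and "shattered (star_class V E) (closed_nbhd E x)"
      by (auto simp: max_degree_vertices_def)
    then show "\<exists>S\<subseteq>V. shattered (star_class V E) S \<and> card S = max_degree V E + 1"
      using closed_nbhd_subset[OF G] card_closed_nbhd[OF G] by metis
  qed
  finally show ?thesis .
qed

theorem theorem3:
  fixes V :: "'a set" and E :: "'a set set"
    and m :: nat and Vs N :: "nat \<Rightarrow> 'a set"
  assumes "simple_graph V E"
    and "bij_betw Vs {1..m} (max_degree_vertices V E // twin_rel V E)"
    and "\<And>i x. i \<in> {1..m} \<Longrightarrow> x \<in> Vs i \<Longrightarrow> closed_nbhd E x = N i"
  shows "VCD V (star_class V E) = max_degree V E + 1 \<longleftrightarrow>
         (\<exists>i\<in>{1..m}. \<exists>v\<in>V. v \<notin> N i \<and> N i - Vs i \<subseteq> closed_nbhd E v)"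
proof -
  let ?P = "\<lambda>N T. \<exists>v\<in>V. v \<notin> N \<and> N - T \<subseteq> closed_nbhd E v"
  have classes: "Vs ` {1..m} = max_degree_vertices V E // twin_rel V E"
    using assms(2) by (simp add: bij_betw_def)
  \<comment> \<open>A representative belongs to its own class, so the assumption on
    \<open>N i\<close> applies to it; this lets the criterion pass between representatives and
    indices.\<close>
  have N: "N i = closed_nbhd E x"
    if "i \<in> {1..m}" "x \<in> max_degree_vertices V E" "Vs i = twin_rel V E `` {x}" for i x
  proof -
    have "x \<in> Vs i" using that by (simp add: twin_rel_def)
    then show ?thesis using assms(3) that(1) by simp
  qed
  have "VCD V (star_class V E) = max_degree V E + 1 \<longleftrightarrow>
        (\<exists>x\<in>max_degree_vertices V E. ?P (closed_nbhd E x) (twin_rel V E `` {x}))"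
    unfolding VCD_star_class_eq_iff[OF assms(1)]
    by (rule bex_cong[OF refl shattered_closed_nbhd_iff[OF assms(1)]])
  also have "\<dots> \<longleftrightarrow> (\<exists>i\<in>{1..m}. ?P (N i) (Vs i))"
  proof
    assume "\<exists>x\<in>max_degree_vertices V E. ?P (closed_nbhd E x) (twin_rel V E `` {x})"
    then obtain x where x: "x \<in> max_degree_vertices V E"
      and P: "?P (closed_nbhd E x) (twin_rel V E `` {x})" by blast
    from x have "twin_rel V E `` {x} \<in> Vs ` {1..m}"
      unfolding classes by (rule quotientI)
    then obtain i where i: "i \<in> {1..m}" "Vs i = twin_rel V E `` {x}" by (metis imageE)
    have "?P (N i) (Vs i)" using P unfolding N[OF i(1) x i(2)] i(2) .
    with i(1) show "\<exists>i\<in>{1..m}. ?P (N i) (Vs i)" ..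
  next
    assume "\<exists>i\<in>{1..m}. ?P (N i) (Vs i)"
    then obtain i where i: "i \<in> {1..m}" and P: "?P (N i) (Vs i)" by blast
    from i have "Vs i \<in> max_degree_vertices V E // twin_rel V E"
      using classes by blast
    then obtain x where x: "x \<in> max_degree_vertices V E" "Vs i = twin_rel V E `` {x}"
      by (rule quotientE)
    have "?P (closed_nbhd E x) (twin_rel V E `` {x})" using P unfolding N[OF i x] x(2) .
    with x(1)
    show "\<exists>x\<in>max_degree_vertices V E. ?P (closed_nbhd E x) (twin_rel V E `` {x})" ..
  qed
  finally show ?thesis .
qed

end
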